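(* Let $n \equiv 2 \pmod 4$, let $C$ be a singly even self-dual code of length $n$ with minimum weight $d(C)$, and let $S$ be the shadow of $C$, with minimum weight $d(S)$. Assume that $d(S)=\frac{d(C)}{2}+1$. Let $B_{d(S)}$ be the number of vectors of weight $d(S)$ in $S$. Then \[ B_{d(S)}\leq \max\{ M_{v,d(S)}+M_{n-v,d(S)} \mid v\in\mathbb{Z},\ 0\leq v \leq n/2 \}, \] where the numbers $M_{v,d}$ are as defined in the context.
   Context: All codes are binary linear codes. The weight of a vector is its number of nonzero components, and the minimum weight of a code is the smallest nonzero weight of its codewords. A code $C$ is self-dual if $C=C^\perp$ with respect to the standard inner product; a self-dual code is singly even if it contains a codeword of weight $\equiv 2 \pmod 4$. For a singly even self-dual code $C$, let $C_0$ be the subcode of codewords of weight $\equiv 0 \pmod 4$ (it has codimension $1$ in $C$). The shadow of $C$ is $S=C_0^\perp\setminus C$, and $d(S)$ denotes the minimum weight of the vectors in $S$. For integers $v\ge 2d$, the Johnson graph $J(v,d)$ has as vertices the $d$-subsets of $\{1,\dots,v\}$, with relations $R_i=\{(x,y) : |x\cap y|=d-i\}$, $0\le i\le d$. Let $Q=(q^{(v)}_j(i))_{0\le i,j\le d}$ be its second eigenmatrix, i.e. explicitly \[ q^{(v)}_j(x)=\left(\binom{v}{j}-\binom{v}{j-1}\right)\sum_{i=0}^{j}(-1)^i\frac{\binom{j}{i}\binom{v+1-j}{i}}{\binom{d}{i}\binom{v-d}{i}}\binom{x}{i}, \] with the convention $\binom{v}{-1}=0$. For $v\ge 2d$ define \[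 M_{v,d}=\min\left\{ 1-\frac{q^{(v)}_j(0)}{q^{(v)}_j(d-1)} \;\middle|\; 1\leq j\leq d\text{ and }q_j^{(v)}(d-1)<0\right\}, \] and for $0\le v\le 2d-1$ define $M_{v,d}=2$ if $v=2d-1$, $M_{v,d}=1$ if $d\leq v\leq 2d-2$, and $M_{v,d}=0$ if $0\leq v\leq d-1$. *)

theory Defs
  imports "HOL-Analysis.Analysis" "HOL-Library.Z2"
begin

text \<open>Vectors of length \<open>n\<close> over the field \<^typ>\<open>bit\<close> of two elements are
  elements of \<open>bit ^ 'n\<close> with \<open>n = CARD('n)\<close>.\<close>

definition weight :: "bit ^ 'n::finite \<Rightarrow> nat" where
  "weight x = card {i. x $ i \<noteq> 0}"

text \<open>The zero vector is ignored, so this makes sense both for codes and for shadows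
  (which never contain it).\<close>

definition min_weight :: "(bit ^ 'n::finite) set \<Rightarrow> nat" where
  "min_weight A = Min {weight x | x. x \<in> A \<and> x \<noteq> 0}"

definition linear_code :: "(bit ^ 'n::finite) set \<Rightarrow> bool" where
  "linear_code C \<longleftrightarrow> vec.subspace C"

definition dual_code :: "(bit ^ 'n::finite) set \<Rightarrow> (bit ^ 'n) set" where
  "dual_code C = {x. \<forall>c\<in>C. scalar_product x c = 0}"

definition self_dual :: "(bit ^ 'n::finite) set \<Rightarrow> bool" where
  "self_dual C \<longleftrightarrow> linear_code C \<and> C = dual_code C"

definition singly_even_self_dual :: "(bit ^ 'n::finite) set \<Rightarrow> bool" where
  "singly_even_self_dual C \<longleftrightarrow> self_dual C \<and> (\<exists>c\<in>C. weight c mod 4 = 2)"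

definition doubly_even_subcode :: "(bit ^ 'n::finite) set \<Rightarrow> (bit ^ 'n) set" where
  "doubly_even_subcode C = {c \<in> C. weight c mod 4 = 0}"

definition shadow :: "(bit ^ 'n::finite) set \<Rightarrow> (bit ^ 'n) set" where
  "shadow C = dual_code (doubly_even_subcode C) - C"

text \<open>\<open>johnson_q v d j x\<close> is the entry \<open>q\<^sub>j(x)\<close> of the second eigenmatrix of the Johnson
  scheme \<open>J(v,d)\<close>; it is only meaningful for \<open>2 * d \<le> v\<close> and \<open>j, x \<le> d\<close>, where no
  subtraction below is truncated. The conditional encodes the convention that
  \<open>v\<close> choose \<open>-1\<close> is \<open>0\<close>.\<close>

definition johnson_q :: "nat \<Rightarrow> nat \<Rightarrow> nat \<Rightarrow> nat \<Rightarrow> real" where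
  "johnson_q v d j x =
     (real (v choose j) - (if j = 0 then 0 else real (v choose (j - 1)))) *
     (\<Sum>i = 0..j. (-1) ^ i *
        (real (j choose i) * real ((v + 1 - j) choose i)) /
        (real (d choose i) * real ((v - d) choose i)) * real (x choose i))"

text \<open>In the first case the set is nonempty as soon as \<open>2 \<le> d\<close>; the minimum weight of a
  shadow with \<open>d(S) = d(C)/2 + 1\<close> is at least 2, so smaller \<open>d\<close> do not matter.\<close>

definition johnson_M :: "nat \<Rightarrow> nat \<Rightarrow> real" where
  "johnson_M v d =
     (if 2 * d \<le> v then
        Min {1 - johnson_q v d j 0 / johnson_q v d j (d - 1) | j.
               1 \<le> j \<and> j \<le> d \<and> johnson_q v d j (d - 1) < 0}
      else if v + 1 = 2 * d then 2
      else if d \<le> v then 1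
      else 0)"

end

(* Two minimum-weight shadow vectors sum to a codeword of weight at least d(C) = 2 d(S) - 2, so
   their supports meet in at most one point. All shadow weights are odd, so the supports of x and y
   meet in exactly one point if x + y is doubly even, and are disjoint otherwise. Fixing x0, the
   class of x0 + x splits the vectors into two families on disjoint coordinate sets, and within each
   family any two supports meet in one point: each is a clique of relation R_(d-1) in a Johnson
   graph, to which Delsarte's bound applies.

   The bound needs q_j(|x - y|) to be a positive semidefinite kernel on d-sets. Up to a nonnegative
   factor it is the sum, over all tuples of j disjoint pairs of points (a_i, b_i), of
   f(x) f(y) with f(x) = prod_i ([a_i in x] - [b_i in x]). Splitting off one pair gives a recursion
   in j, which the hypergeometric formula for q_j satisfies as well. *)
theory Submission
  imports Defs
begin

section \<open>Falling factorials and Hahn polynomials\<close>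

definition falling :: "real \<Rightarrow> nat \<Rightarrow> real" where
  "falling x k = (\<Prod>i<k. x - real i)"

lemma falling_0 [simp]: "falling x 0 = 1"
  by (simp add: falling_def)

lemma falling_Suc: "falling x (Suc k) = falling x k * (x - real k)"
  by (simp add: falling_def)

lemma falling_Suc': "falling x (Suc k) = x * falling (x - 1) k"
  unfolding falling_def by (subst prod.lessThan_Suc_shift) (simp add: algebra_simps)

lemma falling_add: "falling x (m + k) = falling x m * falling (x - real m) k"
  by (induction k) (simp_all add: falling_Suc algebra_simps)

lemma binomial_falling: "real (n choose k) = falling (real n) k / fact k"
  by (simp add: binomial_gbinomial gbinomial_prod_rev falling_def lessThan_atLeast0)

lemma falling_pos: "k \<le> n \<Longrightarrow> 0 < falling (real n) k"
  unfolding falling_def by (intro prod_pos) auto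

text \<open>The term \<open>(d - r) * (w - r)\<close> counts the pairs with one point in \<open>x \<inter> y\<close> and one outside
  \<open>x \<union> y\<close>, and \<open>r\<^sup>2\<close> those with one point in \<open>x - y\<close> and one in \<open>y - x\<close>, for \<open>d\<close>-sets \<open>x\<close>, \<open>y\<close> in
  a \<open>(d + w)\<close>-set with \<open>r = card (x - y)\<close>.\<close>

fun hahn :: "nat \<Rightarrow> real \<Rightarrow> real \<Rightarrow> real \<Rightarrow> real" where
  "hahn 0 d w r = 1"
| "hahn (Suc j) d w r =
     (d - r) * (w - r) * hahn j (d - 1) (w - 1) r - r\<^sup>2 * hahn j (d - 1) (w - 1) (r - 1)"

text \<open>Induction on \<open>j\<close>. Each summand of the closed form for \<open>d - 1\<close>,
  \<open>w - 1\<close>, taken at \<open>r\<close> and at \<open>r - 1\<close>, combines into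
  multiples of \<open>X i\<close> and \<open>X (Suc i)\<close>; collecting the coefficient of each
  \<open>X i\<close> leaves a Pascal-type recursion.\<close>

lemma hahn_eq_sum:
  "hahn j d w r = (\<Sum>i\<le>j. (-1) ^ i * real (j choose i) * falling (d + w + 1 - real j) i *
     falling r i * (falling (d - real i) (j - i) * falling (w - real i) (j - i)))"
proof (induction j arbitrary: d w r)
  case 0
  show ?case by simp
next
  case (Suc j)
  define s where "s = d + w"
  define G where "G i = falling (d - real i) (Suc j - i) * falling (w - real i) (Suc j - i)" for i
  define t where "t i = (-1) ^ i * real (j choose i) * falling (s - 1 - real j) i" for i
  define X where "X i = falling r i * G i" for i
  have t0: "t 0 = 1"
    by (simp add: t_def)
  have G_Suc: "G i = (d - real i) * (w - real i) * G (Suc i)" if "i \<le> j" for i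
    using that by (simp add: G_def Suc_diff_le falling_Suc' algebra_simps)
  have IH: "hahn j (d - 1) (w - 1) r' = (\<Sum>i\<le>j. t i * falling r' i * G (Suc i))" for r'
    unfolding Suc.IH by (intro sum.cong refl) (simp add: t_def G_def s_def algebra_simps)
  \<comment> \<open>The quadratic terms in \<open>r\<close> cancel: \<open>(d - r) * (w - r) - r *
    (r - i) = (d - i) * (w - i) - (s - i) * (r - i)\<close>. The product
    \<open>(d - i) * (w - i)\<close> turns \<open>G (Suc i)\<close> into \<open>G i\<close>, and the
    factor \<open>r - i\<close> turns \<open>falling r i\<close> into
    \<open>falling r (Suc i)\<close>.\<close>
  have term_eq: "(d - r) * (w - r) * (t i * falling r i * G (Suc i))
      - r\<^sup>2 * (t i * falling (r - 1) i * G (Suc i))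
      = t i * X i - t i * (s - real i) * X (Suc i)" if "i \<le> j" for i
  proof -
    have r: "r\<^sup>2 * falling (r - 1) i = r * (r - real i) * falling r i"
      by (metis falling_Suc falling_Suc' mult.assoc mult.commute power2_eq_square)
    have "(d - r) * (w - r) * (t i * falling r i * G (Suc i))
      - r\<^sup>2 * (t i * falling (r - 1) i * G (Suc i))
      = t i * G (Suc i) * ((d - r) * (w - r) * falling r i - r\<^sup>2 * falling (r - 1) i)"
      by (simp add: algebra_simps)
    also have "\<dots> = t i * X i - t i * (s - real i) * X (Suc i)"
      unfolding r X_def G_Suc[OF that] falling_Suc s_def by (simp add: algebra_simps)
    finally show ?thesis .
  qed
  have coeff: "(-1) ^ Suc i * real (Suc j choose Suc i) * falling (s - real j) (Suc i)
      = t (Suc i) - t i * (s - real i)" for i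
  proof -
    \<comment> \<open>After Pascal's rule this is the absorption identity
      \<open>(i + 1) * (j + 1 choose i + 1) = (j + 1) * (j choose i)\<close>.\<close>
    have binom: "real (Suc j choose Suc i) * (s - real j)
        = real (j choose Suc i) * (s - 1 - real j - real i) + real (j choose i) * (s - real i)"
    proof -
      have "(Suc i) * (Suc j choose Suc i) = (j + 1) * (j choose i)"
        using Suc_times_binomial_eq[of j i] by (simp add: ac_simps)
      then have "real ((Suc i) * (Suc j choose Suc i)) = real ((j + 1) * (j choose i))"
        by (rule arg_cong)
      then have "(real i + 1) * (real (j choose i) + real (j choose Suc i)) = (real j + 1) * real (j choose i)"
        by (simp add: algebra_simps)
      then show ?thesis by (simp add: algebra_simps)
    qed
    define f where "f = (-1) ^ i * falling (s - 1 - real j) i"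
    have "(-1) ^ Suc i * real (Suc j choose Suc i) * falling (s - real j) (Suc i)
        = - f * (real (Suc j choose Suc i) * (s - real j))"
      by (simp add: f_def falling_Suc' algebra_simps)
    also have "\<dots> = - f * real (j choose Suc i) * (s - 1 - real j - real i)
        - f * real (j choose i) * (s - real i)"
      unfolding binom by (simp add: algebra_simps)
    also have "\<dots> = t (Suc i) - t i * (s - real i)"
      by (simp add: t_def falling_Suc f_def del: diff_diff_eq2 diff_diff_eq)
    finally show ?thesis .
  qed
  have "hahn (Suc j) d w r
      = (\<Sum>i\<le>j. (d - r) * (w - r) * (t i * falling r i * G (Suc i))
            - r\<^sup>2 * (t i * falling (r - 1) i * G (Suc i)))"
    by (simp add: IH sum_subtractf sum_distrib_left)
  also have "\<dots> = (\<Sum>i\<le>j. t i * X i - t i * (s - real i) * X (Suc i))"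
    by (intro sum.cong refl term_eq) simp
  \<comment> \<open>The added summand \<open>t (Suc j)\<close> is zero, because
    \<open>j choose Suc j\<close> is.\<close>
  also have "\<dots> = (\<Sum>i\<le>Suc j. t i * X i) - (\<Sum>i\<le>j. t i * (s - real i) * X (Suc i))"
    by (simp add: sum_subtractf t_def)
  also have "\<dots> = X 0 + (\<Sum>i\<le>j. (t (Suc i) - t i * (s - real i)) * X (Suc i))"
    by (subst sum.atMost_Suc_shift) (simp add: sum_subtractf left_diff_distrib t0)
  also have "\<dots> = (\<Sum>i\<le>Suc j. (-1) ^ i * real (Suc j choose i) * falling (s - real j) i * X i)"
    by (subst sum.atMost_Suc_shift) (simp only: coeff, simp)
  also have "\<dots> = (\<Sum>i\<le>Suc j. (-1) ^ i * real (Suc j choose i) * falling (d + w + 1 - real (Suc j)) i *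
     falling r i * (falling (d - real i) (Suc j - i) * falling (w - real i) (Suc j - i)))"
    by (intro sum.cong refl) (simp add: X_def G_def s_def algebra_simps)
  finally show ?case .
qed

text \<open>Written with falling factorials, the factorials in each summand cancel. The denominators
  divide \<open>falling d j\<close> and \<open>falling w j\<close>, where \<open>w = v - d\<close>,
  with the cofactors that occur in \<open>hahn_eq_sum\<close>; nothing vanishes since
  \<open>j \<le> d \<le> w\<close>.\<close>

lemma johnson_q_eq_hahn:
  assumes "2 * d \<le> v" "j \<le> d"
  shows "johnson_q v d j x =
    (real (v choose j) - (if j = 0 then 0 else real (v choose (j - 1)))) *
    hahn j (real d) (real (v - d)) (real x) / (falling (real d) j * falling (real (v - d)) j)"
proof -
  define w where "w = v - d"
  have w: "j \<le> w" "v = d + w" using assms by (auto simp: w_def)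
  have "(-1) ^ i * (real (j choose i) * real ((v + 1 - j) choose i)) /
        (real (d choose i) * real (w choose i)) * real (x choose i)
      = (-1) ^ i * real (j choose i) * falling (real d + real w + 1 - real j) i *
     falling x i * (falling (real d - real i) (j - i) * falling (real w - real i) (j - i)) /
      (falling (real d) j * falling (real w) j)" if "i \<le> j" for i
  proof -
    have pos: "falling (real d) i \<noteq> 0" "falling (real w) i \<noteq> 0"
        "falling (real d) j \<noteq> 0" "falling (real w) j \<noteq> 0"
      using falling_pos[of i d] falling_pos[of i w] falling_pos[of j d] falling_pos[of j w] that w assms by auto
    have d: "falling (real d) j = falling (real d) i * falling (real d - real i) (j - i)"
        and w': "falling (real w) j = falling (real w) i * falling (real w - real i) (j - i)"
      using falling_add[of _ i "j - i"] that by simp_all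
    have n: "real (v + 1 - j) = real d + real w + 1 - real j"
      using w assms by (simp add: of_nat_diff)
    have pos': "falling (real d - real i) (j - i) \<noteq> 0" "falling (real w - real i) (j - i) \<noteq> 0"
      using pos d w' by auto
    show ?thesis
      unfolding d w' binomial_falling[of "v + 1 - j"] binomial_falling[of d] binomial_falling[of w]
        binomial_falling[of x] n
      using pos pos' by (simp add: field_simps)
  qed
  then have "(\<Sum>i = 0..j. (-1) ^ i *
        (real (j choose i) * real ((v + 1 - j) choose i)) /
        (real (d choose i) * real (w choose i)) * real (x choose i))
     = hahn j (real d) (real w) (real x) / (falling (real d) j * falling (real w) j)"
    unfolding hahn_eq_sum sum_divide_distrib atMost_atLeast0 by (intro sum.cong) auto
  then show ?thesis
    unfolding johnson_q_def w_def by simp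
qed

section \<open>Hahn values at \<open>d\<close> and \<open>d - 1\<close>, and a negative eigenmatrix
  entry\<close>

lemma falling_self: "falling (real n) n = fact n"
  using binomial_falling[of n n] by simp

lemma falling_Suc_self: "falling (1 + real n) n = fact (Suc n)"
  using falling_self[of "Suc n"] by (simp add: falling_Suc add.commute)

text \<open>At \<open>r = d\<close> the first term of the recursion vanishes, and the second stays
  on the diagonal because \<open>d\<close> and \<open>r\<close> drop together.\<close>

lemma hahn_diag: "hahn j d w d = (-1) ^ j * (falling d j)\<^sup>2"
  by (induction j arbitrary: d w) (simp_all add: falling_Suc' power_mult_distrib)

text \<open>The case \<open>j = r = d - 1\<close>. Since \<open>d - r = 1\<close>, the first term of
  the recursion is a diagonal value known from \<open>hahn_diag\<close>, and the second is the same
  kind of value for \<open>d - 1\<close>.\<close>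

lemma hahn_top_neighbour:
  "hahn e (real (Suc e)) w (real e) = (-1) ^ e * (fact e)\<^sup>2 * (1 - real e * (w - real e))"
proof (induction e arbitrary: w)
  case (Suc e)
  have "hahn (Suc e) (real (Suc (Suc e))) w (real (Suc e))
      = (w - real (Suc e)) * hahn e (real (Suc e)) (w - 1) (real (Suc e))
        - (real (Suc e))\<^sup>2 * hahn e (real (Suc e)) (w - 1) (real e)"
    by (simp add: algebra_simps)
  also have "\<dots> = (-1) ^ Suc e * (fact (Suc e))\<^sup>2 * (1 - real (Suc e) * (w - real (Suc e)))"
    unfolding Suc.IH hahn_diag unfolding of_nat_Suc falling_Suc_self fact_Suc power_mult_distrib by (simp add: algebra_simps)
  finally show ?case .
qed simp

text \<open>The case \<open>j = d\<close>, \<open>r = d - 1\<close>, by the same recursion. Its sign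
  alternates with \<open>e\<close>, which settles even \<open>d\<close>.\<close>

lemma hahn_top:
  "hahn (Suc e) (real (Suc e)) w (real e) = (-1) ^ e * (fact e)\<^sup>2 * real (Suc e) * (w - real e)"
proof (induction e arbitrary: w)
  case (Suc e)
  have "hahn (Suc (Suc e)) (real (Suc (Suc e))) w (real (Suc e))
      = (w - real (Suc e)) * hahn (Suc e) (real (Suc e)) (w - 1) (real (Suc e))
        - (real (Suc e))\<^sup>2 * hahn (Suc e) (real (Suc e)) (w - 1) (real e)"
    by (subst hahn.simps(2)) (simp add: algebra_simps del: hahn.simps)
  also have "\<dots> = (-1) ^ Suc e * (fact (Suc e))\<^sup>2 * real (Suc (Suc e)) * (w - real (Suc e))"
    unfolding Suc.IH hahn_diag falling_self fact_Suc power_mult_distrib by (simp add: algebra_simps power2_eq_square)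
  finally show ?case .
qed simp

text \<open>Ensures that the minimum in \<open>johnson_M\<close> is taken over a nonempty set. The
  binomial difference in \<open>johnson_q\<close> is positive for \<open>1 \<le> j \<le> d\<close>,
  so the sign is that of \<open>hahn\<close>.\<close>

lemma ex_johnson_q_neg:
  assumes "2 \<le> d" "2 * d \<le> v"
  shows "\<exists>j. 1 \<le> j \<and> j \<le> d \<and> johnson_q v d j (d - 1) < 0"
proof -
  have neg: "johnson_q v d j (d - 1) < 0"
    if "1 \<le> j" "j \<le> d" "hahn j (real d) (real (v - d)) (real (d - 1)) < 0" for j
  proof -
    have "v choose (j - 1) < v choose j"
      using that assms by (intro binomial_strict_mono) auto
    moreover have "0 < falling (real d) j" "0 < falling (real (v - d)) j"
      by (rule falling_pos; use that assms in linarith)+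
    ultimately show ?thesis
      unfolding johnson_q_eq_hahn[OF assms(2) that(2)]
      using that by (auto intro!: divide_neg_pos mult_pos_neg)
  qed
  \<comment> \<open>\<open>j = d - 1\<close> works for odd \<open>d\<close>, \<open>j = d\<close> for even \<open>d\<close>.\<close>
  obtain e where e: "d = Suc e" "1 \<le> e" using assms by (cases d) auto
  have w: "1 \<le> real (v - d) - real e" using assms e by linarith
  show ?thesis
  proof (cases "odd d")
    case True
    then have e2: "even e" "2 \<le> e" using e by (auto elim: evenE)
    \<comment> \<open>The factor \<open>1 - e * (w - e)\<close> in \<open>hahn_top_neighbour\<close>
      has to be negative, which takes \<open>e * (w - e)\<close> above 1; here \<open>w\<close>
      stands for \<open>v - d\<close>.\<close>
    have "2 * 1 \<le> real e * (real (v - d) - real e)"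
      using e2 w by (intro mult_mono) auto
    then have "hahn e (real d) (real (v - d)) (real (d - 1)) < 0"
      using e2 hahn_top_neighbour[of e "real (v - d)"] by (simp add: e(1) mult_pos_neg)
    then show ?thesis using neg[of e] e by auto
  next
    case False
    then have "odd e" using e by auto
    then have "hahn d (real d) (real (v - d)) (real (d - 1)) < 0"
      using w hahn_top[of e "real (v - d)"] by (simp add: e(1) del: hahn.simps)
    then show ?thesis using neg[of d] assms by (intro exI[of _ d]) simp
  qed
qed

section \<open>Positive semidefiniteness of the Hahn kernels\<close>

definition separation :: "'a \<times> 'a \<Rightarrow> 'a set \<Rightarrow> real" where
  "separation z x = of_bool (fst z \<in> x) - of_bool (snd z \<in> x)"

text \<open>The product of separations is 1 on \<open>P\<close>, where both sets split the pair in
  the same way, -1 on \<open>N\<close>, where they split it in opposite ways, and 0 elsewhere.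
  Deleting a pair in \<open>P\<close> leaves \<open>x - y\<close> unchanged, deleting one in
  \<open>N\<close> removes one point of it. The factor 2 counts the two orders of a pair.\<close>

lemma sum_separation:
  fixes h :: "nat \<Rightarrow> real"
  assumes "finite \<Omega>" "x \<subseteq> \<Omega>" "y \<subseteq> \<Omega>" "card x = d" "card y = d" "card \<Omega> = d + w"
  defines "r \<equiv> card (x - y)"
  shows "(\<Sum>z\<in>\<Omega> \<times> \<Omega>. separation z x * separation z y *
            h (card ((x - {fst z, snd z}) - (y - {fst z, snd z}))))
    = 2 * ((real d - real r) * (real w - real r) * h r - (real r)\<^sup>2 * h (r - 1))"
proof -
  have fin: "finite x" "finite y" using assms finite_subset by auto
  define P where "P = (x \<inter> y) \<times> (\<Omega> - (x \<union> y)) \<union> (\<Omega> - (x \<union> y)) \<times> (x \<inter> y)"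
  define N where "N = (x - y) \<times> (y - x) \<union> (y - x) \<times> (x - y)"
  have cA: "card (x \<inter> y) = d - r" "r \<le> d"
    using fin assms(4) card_Diff_subset_Int[of x y] card_mono[of x "x \<inter> y"] card_mono[of x "x - y"]
    by (auto simp: r_def)
  have cC: "card (y - x) = r"
    using fin assms(4,5) card_Diff_subset_Int[of x y] card_Diff_subset_Int[of y x]
    by (simp add: r_def Int_commute)
  have "card (x \<union> y) = d + r"
    using fin assms(4) cC card_Un_disjoint[of x "y - x"] by auto
  moreover have "card (x \<union> y) \<le> card \<Omega>" "card (\<Omega> - (x \<union> y)) = card \<Omega> - card (x \<union> y)"
    using assms(1-3) fin by (simp_all add: card_mono card_Diff_subset)
  ultimately have cD: "card (\<Omega> - (x \<union> y)) = w - r" "r \<le> w"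
    using assms(6) by auto
  have "card P = 2 * (d - r) * (w - r)"
    unfolding P_def using fin assms(1) cA cD
    by (subst card_Un_disjoint) (auto simp: card_cartesian_product)
  then have "real (card P) = 2 * (real d - real r) * (real w - real r)"
    using cA(2) cD(2) by simp
  moreover have "card N = 2 * r * r"
    unfolding N_def using fin cC
    by (subst card_Un_disjoint) (auto simp: card_cartesian_product r_def)
  moreover have "P \<subseteq> \<Omega> \<times> \<Omega>" "N \<subseteq> \<Omega> \<times> \<Omega>"
    using assms(2,3) by (auto simp: P_def N_def)
  then have "\<Omega> \<times> \<Omega> \<inter> P = P" "\<Omega> \<times> \<Omega> \<inter> N = N" by auto
  moreover have "separation z x * separation z y * h (card ((x - {fst z, snd z}) - (y - {fst z, snd z})))
      = of_bool (z \<in> P) * h r - of_bool (z \<in> N) * h (r - 1)" if z: "z \<in> \<Omega> \<times> \<Omega>" for z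
  proof -
    obtain a b where ab: "z = (a, b)" "a \<in> \<Omega>" "b \<in> \<Omega>" using z by auto
    consider "z \<in> P" | "z \<in> N" | "z \<notin> P" "z \<notin> N" by blast
    then show ?thesis
    proof cases
      case 1
      then have "(x - {a, b}) - (y - {a, b}) = x - y" "z \<notin> N"
        by (auto simp: P_def N_def ab)
      then show ?thesis using 1 by (auto simp: ab separation_def r_def P_def)
    next
      case 2
      then have "(x - {a, b}) - (y - {a, b}) = (x - y) - {if a \<in> x then a else b}"
          "(if a \<in> x then a else b) \<in> x - y"
        by (auto simp: P_def N_def ab)
      then have "card ((x - {a, b}) - (y - {a, b})) = r - 1"
        using fin by (simp only: card_Diff_singleton r_def)
      moreover have "z \<notin> P" using 2 by (auto simp: P_def N_def ab)
      ultimately show ?thesis using 2 by (auto simp: ab separation_def N_def)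
    next
      case 3
      then have "separation z x = 0 \<or> separation z y = 0"
        using ab by (auto simp: P_def N_def separation_def)
      then show ?thesis using 3 by auto
    qed
  qed
  then have "(\<Sum>z\<in>\<Omega> \<times> \<Omega>. separation z x * separation z y *
            h (card ((x - {fst z, snd z}) - (y - {fst z, snd z}))))
     = (\<Sum>z\<in>\<Omega> \<times> \<Omega>. of_bool (z \<in> P)) * h r - (\<Sum>z\<in>\<Omega> \<times> \<Omega>. of_bool (z \<in> N)) * h (r - 1)"
    by (simp add: sum_subtractf sum_distrib_right)
  ultimately have "(\<Sum>z\<in>\<Omega> \<times> \<Omega>. separation z x * separation z y *
            h (card ((x - {fst z, snd z}) - (y - {fst z, snd z}))))
     = 2 * (real d - real r) * (real w - real r) * h r - 2 * real r * real r * h (r - 1)"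
    using assms(1) by (simp add: sum_of_bool_eq)
  then show ?thesis
    by (simp add: power2_eq_square algebra_simps)
qed

text \<open>Families rather than sets, since deleting \<open>{a, b}\<close> from the sets \<open>X p\<close> need not be
  injective.\<close>

lemma hahn_psd:
  fixes X :: "'i \<Rightarrow> 'a set" and c :: "'i \<Rightarrow> real"
  assumes "finite I" "finite \<Omega>" "card \<Omega> = d + w"
    and "\<And>p. p \<in> I \<Longrightarrow> X p \<subseteq> \<Omega> \<and> card (X p) = d"
  shows "0 \<le> (\<Sum>p\<in>I. \<Sum>q\<in>I. c p * c q * hahn j (real d) (real w) (real (card (X p - X q))))"
  using assms
proof (induction j arbitrary: d w I \<Omega> X c)
  case 0
  have "(\<Sum>p\<in>I. \<Sum>q\<in>I. c p * c q) = (\<Sum>p\<in>I. c p)\<^sup>2"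
    by (simp add: power2_eq_square sum_product)
  then show ?case by simp
next
  case (Suc j)
  define h where "h k = hahn j (real d - 1) (real w - 1) (real k)" for k :: nat
  define Y where "Y z p = X p - {fst z, snd z}" for z p
  have fin: "finite (X p)" if "p \<in> I" for p
    using Suc.prems(2,4) that finite_subset by blast
  \<comment> \<open>With \<open>h\<close> the polynomial for \<open>d - 1\<close>,
    \<open>w - 1\<close>, the right side of \<open>sum_separation\<close> is twice the recursion for
    \<open>hahn\<close>.\<close>
  have step: "2 * hahn (Suc j) (real d) (real w) (real (card (X p - X q)))
      = (\<Sum>z\<in>\<Omega> \<times> \<Omega>. separation z (X p) * separation z (X q) * h (card (Y z p - Y z q)))"
    if "p \<in> I" "q \<in> I" for p q
  proof -
    define r where "r = card (X p - X q)"
    \<comment> \<open>At \<open>r = 0\<close> the truncated \<open>r - 1\<close> differs from the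
      real one, but the square annihilates the term.\<close>
    have "(real r)\<^sup>2 * hahn j (real d - 1) (real w - 1) (real r - 1) = (real r)\<^sup>2 * h (r - 1)"
      by (cases r) (auto simp: h_def)
    then have "hahn (Suc j) (real d) (real w) (real r)
        = (real d - real r) * (real w - real r) * h r - (real r)\<^sup>2 * h (r - 1)"
      by (simp add: h_def)
    then show ?thesis
      unfolding Y_def using Suc.prems(4)[OF that(1)] Suc.prems(4)[OF that(2)]
      by (subst sum_separation[OF Suc.prems(2)]) (use Suc.prems(3) in \<open>auto simp: r_def\<close>)
  qed
  have nonneg: "0 \<le> (\<Sum>p\<in>I. \<Sum>q\<in>I. (c p * separation z (X p)) * (c q * separation z (X q)) *
          h (card (Y z p - Y z q)))" if z: "z \<in> \<Omega> \<times> \<Omega>" for z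
  proof -
    \<comment> \<open>Only the sets split by \<open>z\<close> contribute. Deleting the pair takes
      one point off each of them and two off the ground set, so the induction hypothesis applies to
      \<open>d - 1\<close> and \<open>w - 1\<close>, with the separations absorbed into the
      coefficients.\<close>
    define J where "J = {p\<in>I. separation z (X p) \<noteq> 0}"
    obtain a b where ab: "z = (a, b)" "a \<in> \<Omega>" "b \<in> \<Omega>" using z by auto
    have sep: "a \<noteq> b \<and> (a \<in> X p \<longleftrightarrow> b \<notin> X p)" if "p \<in> J" for p
      using that by (auto simp: J_def separation_def ab split: if_splits)
    show ?thesis
    proof (cases "J = {}")
      case True
      then have "\<And>p. p \<in> I \<Longrightarrow> separation z (X p) = 0" by (auto simp: J_def)
      then show ?thesis by simp
    next
      case False
      then obtain p0 where p0: "p0 \<in> J" by auto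
      have Y: "Y z p \<subseteq> \<Omega> - {a, b} \<and> card (Y z p) = d - 1" if "p \<in> J" for p
      proof -
        have "p \<in> I" using that by (simp add: J_def)
        have "Y z p = X p - {if a \<in> X p then a else b}" "(if a \<in> X p then a else b) \<in> X p"
          using sep[OF that] by (auto simp: Y_def ab)
        then have "card (Y z p) = card (X p) - 1"
          using fin[OF \<open>p \<in> I\<close>] by (simp only: card_Diff_singleton)
        then show ?thesis using Suc.prems(4)[OF \<open>p \<in> I\<close>] by (auto simp: Y_def ab)
      qed
      have "p0 \<in> I" using p0 by (simp add: J_def)
      have X0: "X p0 \<subseteq> \<Omega>" "card (X p0) = d" using Suc.prems(4)[OF \<open>p0 \<in> I\<close>] by auto
      \<comment> \<open>A set split by \<open>z\<close> contains one point of the pair and misses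
        the other, so \<open>d\<close> and \<open>w\<close> are positive and their natural
        predecessors agree with the real ones in \<open>h\<close>.\<close>
      have "X p0 \<noteq> {}" using sep[OF p0] by auto
      then have d: "1 \<le> d" using X0 fin[OF \<open>p0 \<in> I\<close>] by (metis card_gt_0_iff less_eq_Suc_le One_nat_def)
      have "X p0 \<subset> \<Omega>" using sep[OF p0] X0 ab by auto
      then have "card (X p0) < card \<Omega>" by (rule psubset_card_mono[OF Suc.prems(2)])
      then have w: "1 \<le> w" using X0 Suc.prems(3) by simp
      have "card (\<Omega> - {a, b}) = card \<Omega> - 2"
        using sep[OF p0] ab Suc.prems(2) by (simp add: card_Diff_subset)
      then have card: "card (\<Omega> - {a, b}) = (d - 1) + (w - 1)"
        using Suc.prems(3) d w by simp
      have "0 \<le> (\<Sum>p\<in>J. \<Sum>q\<in>J. (c p * separation z (X p)) * (c q * separation z (X q)) *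
          hahn j (real (d - 1)) (real (w - 1)) (real (card (Y z p - Y z q))))"
        by (rule Suc.IH[OF _ _ card Y]) (use Suc.prems(1,2) in \<open>auto simp: J_def\<close>)
      also have "\<dots> = (\<Sum>p\<in>J. \<Sum>q\<in>J. (c p * separation z (X p)) * (c q * separation z (X q)) *
          h (card (Y z p - Y z q)))"
        using d w by (simp add: h_def)
      also have "\<dots> = (\<Sum>p\<in>J. \<Sum>q\<in>I. (c p * separation z (X p)) * (c q * separation z (X q)) *
          h (card (Y z p - Y z q)))"
        by (intro sum.cong refl sum.mono_neutral_left) (use Suc.prems(1) in \<open>auto simp: J_def\<close>)
      also have "\<dots> = (\<Sum>p\<in>I. \<Sum>q\<in>I. (c p * separation z (X p)) * (c q * separation z (X q)) *
          h (card (Y z p - Y z q)))"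
        by (intro sum.mono_neutral_left) (use Suc.prems(1) in \<open>auto simp: J_def\<close>)
      finally show ?thesis .
    qed
  qed
  have "2 * (\<Sum>p\<in>I. \<Sum>q\<in>I. c p * c q * hahn (Suc j) (real d) (real w) (real (card (X p - X q))))
      = (\<Sum>p\<in>I. \<Sum>q\<in>I. c p * c q * (2 * hahn (Suc j) (real d) (real w) (real (card (X p - X q)))))"
    by (simp add: sum_distrib_left mult_ac del: hahn.simps)
  also have "\<dots> = (\<Sum>p\<in>I. \<Sum>q\<in>I. \<Sum>z\<in>\<Omega> \<times> \<Omega>. (c p * separation z (X p)) * (c q * separation z (X q)) *
          h (card (Y z p - Y z q)))"
    by (intro sum.cong refl) (simp add: step sum_distrib_left mult.assoc mult.left_commute del: hahn.simps)
  also have "\<dots> = (\<Sum>p\<in>I. \<Sum>z\<in>\<Omega> \<times> \<Omega>. \<Sum>q\<in>I. (c p * separation z (X p)) * (c q * separation z (X q)) *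
          h (card (Y z p - Y z q)))"
    by (intro sum.cong refl sum.swap)
  also have "\<dots> = (\<Sum>z\<in>\<Omega> \<times> \<Omega>. \<Sum>p\<in>I. \<Sum>q\<in>I. (c p * separation z (X p)) * (c q * separation z (X q)) *
          h (card (Y z p - Y z q)))"
    by (rule sum.swap)
  also have "\<dots> \<ge> 0"
    by (intro sum_nonneg nonneg)
  finally show ?case by simp
qed

section \<open>Delsarte's clique bound and the numbers \<open>johnson_M\<close>\<close>

text \<open>At \<open>x = 0\<close> only the summand \<open>i = 0\<close> survives, leaving the
  difference of consecutive binomial coefficients, which increase up to the middle.\<close>

lemma johnson_q_0_nonneg:
  assumes "2 * d \<le> v" "j \<le> d"
  shows "0 \<le> johnson_q v d j 0"
proof -
  have "v choose (j - 1) \<le> v choose j"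
    using assms by (intro binomial_mono) auto
  moreover have "(\<Sum>i = 0..j. (-1) ^ i *
        (real (j choose i) * real ((v + 1 - j) choose i)) /
        (real (d choose i) * real ((v - d) choose i)) * real (0 choose i)) = (1 :: real)"
    by (subst sum.mono_neutral_right[where S = "{0}"]) (auto simp: binomial_eq_0_iff)
  ultimately show ?thesis
    by (auto simp: johnson_q_def)
qed

text \<open>The kernel \<open>q_j\<close> is a nonnegative multiple \<open>K\<close> of the
  semidefinite \<open>hahn\<close> kernel. Summed over \<open>F\<close> with all coefficients 1,
  every row gives one diagonal entry and \<open>card F - 1\<close> entries at \<open>d - 1\<close>,
  so the row sum is nonnegative; dividing by the negative entry bounds
  \<open>card F\<close>.\<close>

lemma johnson_q_clique_bound:
  assumes v: "2 * d \<le> v" "j \<le> d" and neg: "johnson_q v d j (d - 1) < 0"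
    and "finite \<Omega>" "card \<Omega> = v"
    and F: "\<And>x. x \<in> F \<Longrightarrow> x \<subseteq> \<Omega> \<and> card x = d"
    and meet: "\<And>x y. x \<in> F \<Longrightarrow> y \<in> F \<Longrightarrow> x \<noteq> y \<Longrightarrow> card (x \<inter> y) = 1"
  shows "real (card F) \<le> 1 - johnson_q v d j 0 / johnson_q v d j (d - 1)"
proof (cases "F = {}")
  case True
  then show ?thesis
    using johnson_q_0_nonneg[OF v] neg by (simp add: divide_nonneg_neg order_trans[of _ 0])
next
  case False
  have finF: "finite F"
    using F \<open>finite \<Omega>\<close> by (meson PowI finite_Pow_iff finite_subset subsetI)
  have fin: "finite x" if "x \<in> F" for x
    using F[OF that] \<open>finite \<Omega>\<close> finite_subset by blast
  have diff: "card (x - y) = (if x = y then 0 else d - 1)" if "x \<in> F" "y \<in> F" for x y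
    using F[OF that(1)] meet[OF that] fin[OF that(1)] by (auto simp: card_Diff_subset_Int)
  define K where "K = (real (v choose j) - (if j = 0 then 0 else real (v choose (j - 1)))) /
    (falling (real d) j * falling (real (v - d)) j)"
  have K: "johnson_q v d j x = K * hahn j (real d) (real (v - d)) (real x)" for x
    unfolding johnson_q_eq_hahn[OF v] K_def by simp
  have "0 \<le> K"
  proof -
    have "v choose (j - 1) \<le> v choose j"
      using v by (intro binomial_mono) auto
    moreover have "0 < falling (real d) j" "0 < falling (real (v - d)) j"
      by (rule falling_pos; use v in linarith)+
    ultimately show ?thesis by (auto simp: K_def)
  qed
  moreover have "0 \<le> (\<Sum>x\<in>F. \<Sum>y\<in>F. 1 * 1 * hahn j (real d) (real (v - d)) (real (card (x - y))))"
    by (rule hahn_psd[where X = "\<lambda>x. x" and c = "\<lambda>_. 1", OF finF \<open>finite \<Omega>\<close>]) (use assms in auto)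
  ultimately have "0 \<le> K * (\<Sum>x\<in>F. \<Sum>y\<in>F. 1 * 1 * hahn j (real d) (real (v - d)) (real (card (x - y))))"
    by (rule mult_nonneg_nonneg)
  also have "\<dots> = (\<Sum>x\<in>F. \<Sum>y\<in>F. johnson_q v d j (card (x - y)))"
    by (simp add: K sum_distrib_left)
  also have "\<dots> = (\<Sum>x\<in>F. johnson_q v d j 0 + (real (card F) - 1) * johnson_q v d j (d - 1))"
  proof (intro sum.cong refl)
    fix x assume x: "x \<in> F"
    have "(\<Sum>y\<in>F - {x}. johnson_q v d j (card (x - y))) = (\<Sum>y\<in>F - {x}. johnson_q v d j (d - 1))"
      by (intro sum.cong refl) (use x diff in auto)
    moreover have "1 \<le> card F" using finF False by (simp add: Suc_le_eq card_gt_0_iff)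
    ultimately show "(\<Sum>y\<in>F. johnson_q v d j (card (x - y)))
        = johnson_q v d j 0 + (real (card F) - 1) * johnson_q v d j (d - 1)"
      using x finF by (simp add: sum.remove[of F x])
  qed
  also have "\<dots> = real (card F) * (johnson_q v d j 0 + (real (card F) - 1) * johnson_q v d j (d - 1))"
    by simp
  finally have "0 \<le> johnson_q v d j 0 + (real (card F) - 1) * johnson_q v d j (d - 1)"
    using finF False by (simp add: zero_le_mult_iff card_gt_0_iff)
  then show ?thesis
    using neg by (simp add: field_simps)
qed

text \<open>The minimum is attained, so the clique bound for the minimizing \<open>j\<close> is the
  bound by \<open>johnson_M\<close>.\<close>

lemma johnson_M_mem:
  assumes "2 \<le> d" "2 * d \<le> v"
  obtains j where "1 \<le> j" "j \<le> d" "johnson_q v d j (d - 1) < 0"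
    "johnson_M v d = 1 - johnson_q v d j 0 / johnson_q v d j (d - 1)"
proof -
  define A where "A = {1 - johnson_q v d j 0 / johnson_q v d j (d - 1) | j.
               1 \<le> j \<and> j \<le> d \<and> johnson_q v d j (d - 1) < 0}"
  have "finite A"
    by (rule finite_subset[of _ "(\<lambda>j. 1 - johnson_q v d j 0 / johnson_q v d j (d - 1)) ` {1..d}"])
      (auto simp: A_def)
  moreover have "A \<noteq> {}"
    using ex_johnson_q_neg[OF assms] by (auto simp: A_def)
  ultimately have "Min A \<in> A" by simp
  moreover have "johnson_M v d = Min A"
    using assms by (simp add: johnson_M_def A_def)
  ultimately show thesis
    using that by (auto simp: A_def)
qed

lemma johnson_M_nonneg:
  assumes "2 \<le> d"
  shows "0 \<le> johnson_M v d"
proof (cases "2 * d \<le> v")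
  case True
  obtain j where "1 \<le> j" "j \<le> d" "johnson_q v d j (d - 1) < 0"
    "johnson_M v d = 1 - johnson_q v d j 0 / johnson_q v d j (d - 1)"
    using johnson_M_mem[OF assms True] .
  then show ?thesis
    using johnson_q_0_nonneg[OF True \<open>j \<le> d\<close>] by (simp add: divide_nonneg_neg order_trans[of _ 0])
qed (simp add: johnson_M_def)

text \<open>When \<open>2 * d\<close> exceeds \<open>card \<Omega>\<close>, two members already
  cover \<open>2 * d - 1\<close> points, so a pair forces \<open>card \<Omega> = 2 * d - 1\<close>.
  A third member would lie in their union and meet each in one point, giving it at most 2 points,
  against \<open>3 \<le> d\<close>.\<close>

lemma card_le_johnson_M:
  assumes "3 \<le> d" "finite \<Omega>"
    and F: "\<And>x. x \<in> F \<Longrightarrow> x \<subseteq> \<Omega> \<and> card x = d"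
    and meet: "\<And>x y. x \<in> F \<Longrightarrow> y \<in> F \<Longrightarrow> x \<noteq> y \<Longrightarrow> card (x \<inter> y) = 1"
  shows "real (card F) \<le> johnson_M (card \<Omega>) d"
proof (cases "2 * d \<le> card \<Omega>")
  case True
  then obtain j where "j \<le> d" "johnson_q (card \<Omega>) d j (d - 1) < 0"
    "johnson_M (card \<Omega>) d = 1 - johnson_q (card \<Omega>) d j 0 / johnson_q (card \<Omega>) d j (d - 1)"
    using johnson_M_mem[of d "card \<Omega>"] assms(1) by auto
  then show ?thesis
    using johnson_q_clique_bound[OF True _ _ assms(2) refl F meet] by simp
next
  case False
  have finF: "finite F"
    using F \<open>finite \<Omega>\<close> by (meson PowI finite_Pow_iff finite_subset subsetI)
  have fin: "finite x" if "x \<in> F" for x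
    using F[OF that] \<open>finite \<Omega>\<close> finite_subset by blast
  have union: "x \<union> y \<subseteq> \<Omega>" "card (x \<union> y) = 2 * d - 1" if "x \<in> F" "y \<in> F" "x \<noteq> y" for x y
    using F[OF that(1)] F[OF that(2)] fin[OF that(1)] fin[OF that(2)] meet[OF that]
      card_Un_Int[of x y] by auto
  have two: "2 * d \<le> card \<Omega> + 1" if "x \<in> F" "y \<in> F" "x \<noteq> y" for x y
    using union[OF that] card_mono[OF \<open>finite \<Omega>\<close>, of "x \<union> y"] by auto
  have three: False if "x \<in> F" "y \<in> F" "z \<in> F" "x \<noteq> y" "z \<noteq> x" "z \<noteq> y" for x y z
  proof -
    have "card (x \<union> y) = card \<Omega>"
      using union[OF that(1,2,4)] two[OF that(1,2,4)] False by auto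
    then have "x \<union> y = \<Omega>"
      using union[OF that(1,2,4)] card_subset_eq[OF \<open>finite \<Omega>\<close>] by blast
    then have "z = (z \<inter> x) \<union> (z \<inter> y)" using F[OF that(3)] by auto
    then have "card z \<le> card (z \<inter> x) + card (z \<inter> y)"
      using card_Un_le[of "z \<inter> x" "z \<inter> y"] by simp
    then show False
      using F[OF that(3)] meet[OF that(3,1,5)] meet[OF that(3,2,6)] assms(1) by simp
  qed
  consider "F = {}" | x where "F = {x}" | x y where "x \<in> F" "y \<in> F" "x \<noteq> y"
    by blast
  then show ?thesis
  proof cases
    case 1
    then show ?thesis using johnson_M_nonneg assms(1) by simp
  next
    case 2
    then have "d \<le> card \<Omega>" using F[of x] card_mono[OF assms(2), of x] by auto
    then show ?thesis using 2 False by (simp add: johnson_M_def)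
  next
    case 3
    then have "F = {x, y}" using three by blast
    then have "card F = 2" using 3 by simp
    then show ?thesis using two[OF 3] False by (simp add: johnson_M_def)
  qed
qed

section \<open>Binary vectors, supports and weights\<close>

definition supp :: "bit ^ 'n::finite \<Rightarrow> 'n set" where
  "supp x = {i. x $ i \<noteq> 0}"

lemma weight_eq_card_supp: "weight x = card (supp x)"
  by (simp add: weight_def supp_def)

lemma inj_supp: "inj supp"
proof (rule injI)
  fix x y :: "bit ^ 'n"
  assume eq: "supp x = supp y"
  have "x $ i = y $ i" for i
  proof -
    have "i \<in> supp x \<longleftrightarrow> i \<in> supp y" using eq by simp
    then show ?thesis by (cases "x $ i"; cases "y $ i") (auto simp: supp_def)
  qed
  then show "x = y" by (simp add: vec_eq_iff)
qed

lemma weight_eq_0_iff: "weight x = 0 \<longleftrightarrow> x = 0"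
  by (simp add: weight_def vec_eq_iff)

text \<open>The support of a sum is the symmetric difference of the supports. The additive form
  avoids truncated subtraction.\<close>

lemma weight_add: "weight (x + y) + 2 * card (supp x \<inter> supp y) = weight x + weight y"
proof -
  have "supp (x + y) = (supp x - supp y) \<union> (supp y - supp x)"
  proof (rule set_eqI)
    fix i
    show "i \<in> supp (x + y) \<longleftrightarrow> i \<in> (supp x - supp y) \<union> (supp y - supp x)"
      by (cases "x $ i"; cases "y $ i") (auto simp: supp_def)
  qed
  then have "card (supp (x + y)) = card (supp x - supp y) + card (supp y - supp x)"
    by (simp only:) (rule card_Un_disjoint; auto)
  moreover have "card (supp x) = card (supp x - supp y) + card (supp x \<inter> supp y)"
      "card (supp y) = card (supp y - supp x) + card (supp x \<inter> supp y)" for x y :: "bit ^ 'n"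
    by (subst card_Un_disjoint[symmetric]; auto intro!: arg_cong[of _ _ card])+
  ultimately show ?thesis
    unfolding weight_eq_card_supp by (metis (no_types, lifting) add.assoc add.commute mult_2)
qed

lemma scalar_product_eq_0_iff: "scalar_product x y = 0 \<longleftrightarrow> even (card (supp x \<inter> supp y))"
  for x y :: "bit ^ 'n::finite"
proof -
  have "x $ i * y $ i = of_bool (i \<in> supp x \<inter> supp y)" for i
    by (cases "x $ i"; cases "y $ i") (auto simp: supp_def)
  then have "scalar_product x y = (\<Sum>i\<in>UNIV. of_bool (i \<in> supp x \<inter> supp y))"
    unfolding scalar_product_def by (intro sum.cong refl)
  then have "scalar_product x y = of_nat (card (supp x \<inter> supp y))"
    by (simp only: sum_of_bool_eq finite UNIV_I Collect_mem_eq Int_UNIV_left)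
  moreover have "(of_nat k :: bit) = of_bool (odd k)" for k
    by (induction k) auto
  ultimately show ?thesis by simp
qed

lemma scalar_product_add_left: "scalar_product (x + y) z = scalar_product x z + scalar_product y z"
  for x y z :: "bit ^ 'n::finite"
  unfolding scalar_product_def by (simp only: vector_add_component distrib_right sum.distrib)

lemma scalar_product_add_right: "scalar_product x (y + z) = scalar_product x y + scalar_product x z"
  for x y z :: "bit ^ 'n::finite"
  unfolding scalar_product_def by (simp only: vector_add_component distrib_left sum.distrib)

lemma weight_le: "weight x \<le> CARD('n)" for x :: "bit ^ 'n::finite"
  by (simp add: weight_def card_mono)

lemma finite_weights: "finite {weight x | x. P x}" for P :: "bit ^ 'n::finite \<Rightarrow> bool"
  by (rule finite_subset[of _ "{..CARD('n)}"]) (auto simp: weight_le)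

lemma finite_code: "finite A" for A :: "(bit ^ 'n::finite) set"
  using finite by (rule finite_imageD) (rule inj_on_subset[OF inj_supp], simp)

lemma min_weight_le: "x \<in> A \<Longrightarrow> x \<noteq> 0 \<Longrightarrow> min_weight A \<le> weight x"
  unfolding min_weight_def by (rule Min_le[OF finite_weights]) auto

lemma min_weight_pos:
  assumes "x \<in> A" "x \<noteq> 0"
  shows "0 < min_weight A"
proof -
  have "min_weight A \<in> {weight x | x. x \<in> A \<and> x \<noteq> 0}"
    unfolding min_weight_def by (rule Min_in[OF finite_weights]) (use assms in auto)
  then show ?thesis by (auto intro!: gr0I simp: weight_eq_0_iff)
qed

section \<open>Self-dual codes and their shadows\<close>

context
  fixes C :: "(bit ^ 'n::finite) set"
  assumes self_dual: "self_dual C"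
begin

lemma add_mem_code: "x \<in> C \<Longrightarrow> y \<in> C \<Longrightarrow> x + y \<in> C"
proof (rule vec.subspace_add)
  show "vec.subspace C"
    using self_dual unfolding self_dual_def linear_code_def by (rule conjunct1)
qed

lemma mem_code_iff: "x \<in> C \<longleftrightarrow> (\<forall>c\<in>C. scalar_product x c = 0)"
proof -
  have "C = dual_code C"
    using self_dual unfolding self_dual_def by (rule conjunct2)
  then have "x \<in> C \<longleftrightarrow> x \<in> dual_code C"
    by (rule arg_cong)
  then show ?thesis
    unfolding dual_code_def by (simp only: mem_Collect_eq)
qed

lemma even_weight:
  assumes "x \<in> C"
  shows "even (weight x)"
proof -
  have "scalar_product x x = 0"
    using assms mem_code_iff by blast
  then show ?thesis by (simp add: scalar_product_eq_0_iff weight_eq_card_supp)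
qed

text \<open>Orthogonal supports overlap in an even number of points, so weights add modulo 4; all of
  them being 0 or 2 modulo 4, the class is additive.\<close>

lemma doubly_even_add_iff:
  assumes "x \<in> C" "y \<in> C"
  shows "weight (x + y) mod 4 = 0 \<longleftrightarrow> (weight x mod 4 = 0 \<longleftrightarrow> weight y mod 4 = 0)"
proof -
  have "scalar_product x y = 0"
    using assms mem_code_iff by blast
  then obtain k where "card (supp x \<inter> supp y) = 2 * k"
    by (auto simp: scalar_product_eq_0_iff elim: evenE)
  then have "weight (x + y) + 4 * k = weight x + weight y"
    using weight_add[of x y] by simp
  then show ?thesis
    using even_weight[OF assms(1)] even_weight[OF assms(2)] by presburger
qed

lemma one_mem_code: "1 \<in> C"
proof (subst mem_code_iff, rule ballI)
  fix c assume "c \<in> C"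
  moreover have "supp (1 :: bit ^ 'n) = UNIV" by (simp add: supp_def)
  ultimately show "scalar_product 1 c = 0"
    using even_weight by (simp add: scalar_product_eq_0_iff weight_eq_card_supp)
qed

text \<open>A shadow vector is orthogonal to the doubly even subcode but not to some
  \<open>e\<close> in \<open>C\<close>. If \<open>c\<close> is orthogonal to it,
  \<open>c + e\<close> is not, so neither \<open>e\<close> nor \<open>c + e\<close> is doubly even,
  and then \<open>c\<close> must be.\<close>

lemma shadow_scalar_product:
  assumes "x \<in> shadow C" "c \<in> C"
  shows "scalar_product x c = 0 \<longleftrightarrow> weight c mod 4 = 0"
proof
  have *: "scalar_product x c = 0" if "c \<in> C" "weight c mod 4 = 0" for c
    using assms(1) that by (auto simp: shadow_def dual_code_def doubly_even_subcode_def)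
  then show "weight c mod 4 = 0 \<Longrightarrow> scalar_product x c = 0"
    using assms(2) .
  assume c: "scalar_product x c = 0"
  have "x \<notin> C"
    using assms(1) by (simp add: shadow_def)
  then obtain e where e: "e \<in> C" "scalar_product x e \<noteq> 0"
    using mem_code_iff[of x] by blast
  then have "weight e mod 4 \<noteq> 0" using * by blast
  moreover have "weight (c + e) mod 4 \<noteq> 0"
    using *[of "c + e"] e c assms(2) by (auto simp: scalar_product_add_right add_mem_code)
  ultimately show "weight c mod 4 = 0"
    using doubly_even_add_iff[OF assms(2) e(1)] by auto
qed

text \<open>By \<open>shadow_scalar_product\<close> both vectors pair equally with every codeword,
  so their sum is orthogonal to \<open>C\<close>.\<close>

lemma shadow_add_mem_code:
  assumes "x \<in> shadow C" "y \<in> shadow C"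
  shows "x + y \<in> C"
proof (subst mem_code_iff, rule ballI)
  fix c assume "c \<in> C"
  then have "scalar_product x c = 0 \<longleftrightarrow> scalar_product y c = 0"
    using shadow_scalar_product[OF assms(1)] shadow_scalar_product[OF assms(2)] by simp
  then show "scalar_product (x + y) c = 0"
    unfolding scalar_product_add_left
    by (cases "scalar_product x c"; cases "scalar_product y c") simp_all
qed

text \<open>Pair \<open>x\<close> with the all-one codeword, whose weight is 2 modulo 4.\<close>

lemma odd_weight_shadow:
  assumes "x \<in> shadow C" "CARD('n) mod 4 = 2"
  shows "odd (weight x)"
proof -
  have "supp (1 :: bit ^ 'n) = UNIV" by (simp add: supp_def)
  then have "scalar_product x 1 \<noteq> 0"
    using shadow_scalar_product[OF assms(1) one_mem_code] assms(2) by (simp add: weight_eq_card_supp)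
  then show ?thesis
    using \<open>supp 1 = UNIV\<close> by (simp add: scalar_product_eq_0_iff weight_eq_card_supp)
qed

section \<open>Splitting the shadow vectors of weight \<open>d\<close> into two cliques\<close>

lemma card_min_shadow_le:
  assumes "CARD('n) mod 4 = 2"
    and S: "\<And>x. x \<in> S \<Longrightarrow> x \<in> shadow C \<and> weight x = d"
    and d: "2 * d = min_weight C + 2" "S \<noteq> {}" "min_weight C \<noteq> 0"
  shows "\<exists>v. 2 * v \<le> CARD('n) \<and> real (card S) \<le> johnson_M v d + johnson_M (CARD('n) - v) d"
proof -
  obtain x0 where x0: "x0 \<in> S" using d by auto
  have "odd d" using odd_weight_shadow[OF _ assms(1)] S[OF x0] by blast
  moreover have "2 \<le> d" using d by simp
  ultimately have "3 \<le> d" by (cases "d = 2") auto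
  have supp: "card (supp x) = d" if "x \<in> S" for x
    using S[OF that] by (simp add: weight_eq_card_supp)
  have wt: "weight (x + y) + 2 * card (supp x \<inter> supp y) = 2 * d" if "x \<in> S" "y \<in> S" for x y
    using weight_add[of x y] S[OF that(1)] S[OF that(2)] by simp
  \<comment> \<open>The codeword \<open>x + y\<close> is nonzero and has weight at least
    \<open>2 * d - 2\<close>, while its weight is \<open>2 * d\<close> minus twice the
    overlap.\<close>
  have le1: "card (supp x \<inter> supp y) \<le> 1" if "x \<in> S" "y \<in> S" "x \<noteq> y" for x y
  proof -
    have "x + y \<in> C" using S that shadow_add_mem_code by blast
    moreover have "x + y \<noteq> 0"
    proof
      assume "x + y = 0"
      then have "card (supp x \<inter> supp y) = d"
        using wt[OF that(1,2)] by (simp add: weight_def)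
      then have "supp x = supp y"
        using supp[OF that(1)] supp[OF that(2)]
        by (metis card_subset_eq finite inf_le1 inf_le2)
      then show False using inj_supp that(3) by (auto dest: injD)
    qed
    ultimately have "min_weight C \<le> weight (x + y)"
      by (intro min_weight_le)
    then show ?thesis using wt[OF that(1,2)] d by simp
  qed
  \<comment> \<open>As \<open>d\<close> is odd, overlap 1 gives weight \<open>2 * d - 2\<close>,
    divisible by 4, and overlap 0 gives \<open>2 * d\<close>, which is 2 modulo 4.\<close>
  have meet: "card (supp x \<inter> supp y) = (if weight (x + y) mod 4 = 0 then 1 else 0)"
    if "x \<in> S" "y \<in> S" "x \<noteq> y" for x y
  proof -
    have "card (supp x \<inter> supp y) = 0 \<or> card (supp x \<inter> supp y) = 1"
      using le1[OF that] by linarith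
    then show ?thesis
      using wt[OF that(1,2)] \<open>odd d\<close> by (elim disjE) (simp_all, presburger+)
  qed
  define F where "F b = {x\<in>S. (weight (x0 + x) mod 4 = 0) = b}" for b
  \<comment> \<open>In characteristic 2 the vector \<open>x0\<close> cancels from
    \<open>(x0 + x) + (x0 + y)\<close>, and \<open>doubly_even_add_iff\<close> compares the
    classes.\<close>
  have same_class: "weight (x + y) mod 4 = 0 \<longleftrightarrow> b = b'" if "x \<in> F b" "y \<in> F b'" for x y b b'
  proof -
    have C: "x0 + x \<in> C" "x0 + y \<in> C"
      using that x0 S shadow_add_mem_code by (auto simp: F_def)
    have "(x0 + x) + (x0 + y) = x + y"
      by (intro vec_eq_iff[THEN iffD2] allI) (auto simp del: bit_not_zero_iff bit_not_one_iff)
    then show ?thesis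
      using doubly_even_add_iff[OF C] that by (auto simp: F_def)
  qed
  \<comment> \<open>The points covered by one family; supports in the other family are disjoint from
    these, so it lives on the complement.\<close>
  define \<Omega> where "\<Omega> = \<Union> (supp ` F True)"
  have FS: "F b \<subseteq> S" for b by (auto simp: F_def)
  have pair: "card (u \<inter> w) = 1" if u: "u \<in> supp ` F b" and w: "w \<in> supp ` F b" and "u \<noteq> w" for u w b
  proof -
    obtain x y where xy: "x \<in> F b" "y \<in> F b" and uw: "u = supp x" "w = supp y"
      using u w by blast
    have "x \<in> S" "y \<in> S" "x \<noteq> y" using xy uw FS \<open>u \<noteq> w\<close> by auto
    then show ?thesis using meet[of x y] same_class[OF xy] uw by simp
  qed
  have card_F: "card (supp ` F b) = card (F b)" for b
    by (rule card_image) (rule inj_on_subset[OF inj_supp], simp)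
  have T: "real (card (F True)) \<le> johnson_M (card \<Omega>) d"
    unfolding card_F[symmetric]
  proof (rule card_le_johnson_M[OF \<open>3 \<le> d\<close>])
    show "u \<subseteq> \<Omega> \<and> card u = d" if "u \<in> supp ` F True" for u
      using that supp FS by (auto simp: \<Omega>_def)
  qed (use pair in auto)
  have disjoint: "supp y \<subseteq> - \<Omega>" if y: "y \<in> F False" for y
  proof -
    have "supp x \<inter> supp y = {}" if x: "x \<in> F True" for x
    proof -
      have "x \<noteq> y" using x y by (auto simp: F_def)
      moreover have "x \<in> S" "y \<in> S" using x y FS by auto
      ultimately have "card (supp x \<inter> supp y) = 0"
        using meet[of x y] same_class[OF x y] by simp
      then show ?thesis by simp
    qed
    then show ?thesis by (auto simp: \<Omega>_def)
  qed
  have N: "real (card (F False)) \<le> johnson_M (card (- \<Omega>)) d"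
    unfolding card_F[symmetric]
  proof (rule card_le_johnson_M[OF \<open>3 \<le> d\<close>])
    show "u \<subseteq> - \<Omega> \<and> card u = d" if "u \<in> supp ` F False" for u
      using that supp FS by (auto dest: disjoint[THEN subsetD])
  qed (use pair in auto)
  have "S = F True \<union> F False" "F True \<inter> F False = {}" by (auto simp: F_def)
  then have "card S = card (F True) + card (F False)"
    by (metis card_Un_disjoint finite_code)
  then have bound: "real (card S) \<le> johnson_M (card \<Omega>) d + johnson_M (card (- \<Omega>)) d"
    using T N by simp
  have compl: "card \<Omega> \<le> CARD('n)" "card (- \<Omega>) = CARD('n) - card \<Omega>"
    by (simp_all add: card_mono Compl_eq_Diff_UNIV card_Diff_subset)
  show ?thesis
  \<comment> \<open>The bound is symmetric in the two parts, so the smaller one supplies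
    \<open>v\<close>.\<close>
  proof (cases "2 * card \<Omega> \<le> CARD('n)")
    case True
    then show ?thesis using bound compl by (intro exI[of _ "card \<Omega>"]) simp
  next
    case False
    then show ?thesis using bound compl by (intro exI[of _ "card (- \<Omega>)"]) simp
  qed
qed

end

theorem mainTheorem1:
  fixes C :: "(bit ^ 'n::finite) set"
  assumes "CARD('n) mod 4 = 2"
    and "singly_even_self_dual C"
    and "real (min_weight (shadow C)) = real (min_weight C) / 2 + 1"
  shows "real (card {x \<in> shadow C. weight x = min_weight (shadow C)})
         \<le> Max {johnson_M v (min_weight (shadow C))
                + johnson_M (CARD('n) - v) (min_weight (shadow C)) | v :: nat.
                  real v \<le> real CARD('n) / 2}"
proof -
  define d where "d = min_weight (shadow C)"
  define S where "S = {x \<in> shadow C. weight x = d}"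
  define A where "A = {johnson_M v d + johnson_M (CARD('n) - v) d | v :: nat.
                  real v \<le> real CARD('n) / 2}"
  have sd: "self_dual C"
    using assms(2) by (simp add: singly_even_self_dual_def)
  obtain c where c: "c \<in> C" "weight c mod 4 = 2"
    using assms(2) by (auto simp: singly_even_self_dual_def)
  then have "c \<noteq> 0" by (metis weight_eq_0_iff mod_0 zero_neq_numeral)
  then have pos: "0 < min_weight C" using min_weight_pos c by blast
  have d: "2 * d = min_weight C + 2"
    using assms(3) by (simp add: d_def)
  have "finite A"
    by (rule finite_subset[of _ "(\<lambda>v. johnson_M v d + johnson_M (CARD('n) - v) d) ` {..CARD('n)}"])
      (auto simp: A_def)
  obtain v where v: "2 * v \<le> CARD('n)"
      "real (card S) \<le> johnson_M v d + johnson_M (CARD('n) - v) d"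
  \<comment> \<open>An empty \<open>S\<close> needs only that \<open>johnson_M\<close> is
    nonnegative, and \<open>v = 0\<close> serves.\<close>
  proof (cases "S = {}")
    case True
    then show ?thesis
      using that[of 0] johnson_M_nonneg[of d] d pos by (simp add: add_nonneg_nonneg)
  next
    case False
    then show ?thesis
      using card_min_shadow_le[OF sd assms(1), of S d] False d pos that by (auto simp: S_def)
  qed
  have "johnson_M v d + johnson_M (CARD('n) - v) d \<in> A"
    using v(1) by (auto simp: A_def intro!: exI[of _ v])
  then have "johnson_M v d + johnson_M (CARD('n) - v) d \<le> Max A"
    using \<open>finite A\<close> by (rule Max_ge[rotated])
  then show ?thesis
    using v(2) by (simp add: S_def A_def d_def)
qed

end
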